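(* Consider a convex scenario program (as described in the context) satisfying the Feasibility-and-Uniqueness and Non-Degeneracy assumptions, with support-constraint bound $\zeta$, and let $N>\zeta$ and $M$ be the numbers of design and validation scenarios. Let $\beta\in(0,1)$ and let real coefficients $a_0,\dots,a_N$ satisfy $$a_m\ge0\ (m=0,\dots,N),\qquad\sum_{m=\zeta}^{N-1}a_m>0,\qquad\sum_{m=0}^Na_m=1.$$ For $k\in\{0,\dots,\zeta\}$ and $l\in\{0,\dots,M\}$ define the polynomial in $t$ $$h_{N,M}(t;k,l)=\beta\sum_{m=k}^Na_m\binom{m}{k}t^{m-k}-\binom{N}{k}t^{N-k}B_M(1-t;l),$$ where $B_M(t;l)=\sum_{i=0}^l\binom{M}{i}t^i(1-t)^{M-i}$. Then: (i) For all $k\in\{0,\dots,\zeta\}$ and $l\in\{0,\dots,M\}$, $h_{N,M}(\cdot;k,l)$ has exactly one root in the interval $(0,1)$. (ii) Denoting this root by $t_{N,M}(k,l)$ and setting $\epsilon_{N,M}(k,l)=1-t_{N,M}(k,l)$, one has, for all $k\in\{0,\dots,\zeta\}$ and $l\in\{0,\dots,M-1\}$, $$t_{N,M}(k,l)>t_{N,M}(k,l+1),\qquad\epsilon_{N,M}(k,l)<\epsilon_{N,M}(k,l+1).$$ (iii) The following finite-sample probabilistic guarantee holds: $$\mathbb{P}^{N+M}\left\{V(\mathbf{x}_N^* )>\epsilon_{N,M}(s_N^*,r_M^* )\right\}\le\beta.$$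
   Context: Scenario setting. $(\Delta,\mathcal{F},\mathbb{P})$ is a probability space; $(\Delta^m,\mathcal{F}^m,\mathbb{P}^m)$ is its $m$-fold product, so samples are independent with law $\mathbb{P}$. $\mathcal{X}\subseteq\mathbb{R}^d$ is convex and closed, $J:\mathbb{R}^d\to\mathbb{R}$ is convex, and $f(\mathbf{x},\delta)$ is lower semi-continuous and convex in $\mathbf{x}\in\mathbb{R}^d$ for each fixed $\delta\in\Delta$. For $\omega_m=\{\delta^{(1)},\dots,\delta^{(m)}\}\in\Delta^m$, the scenario program $\mathrm{SP}_m[\omega_m]$ is: minimize $J(\mathbf{x})$ over $\mathbf{x}\in\mathcal{X}$ subject to $f(\mathbf{x},\delta^{(i)})\le0$ for $i=1,\dots,m$ (for $m=0$ there are no scenario constraints). Feasibility and Uniqueness: for every $m\ge0$ and every $\omega_m\in\Delta^m$, the optimal solution $\mathbf{x}_m^*$ of $\mathrm{SP}_m[\omega_m]$ exists and is unique. Violation probability: $V(\mathbf{x})=\mathbb{P}\{\delta\in\Delta: f(\mathbf{x},\delta)>0\}$. The usual measurability of $V(\mathbf{x}_m^* )$ and of the other random quantities involved is assumed. Support constraint: a scenario constraint of $\mathrm{SP}_m[\omega_m]$ whose removal yields a different optimal solution. $s_m^*$ denotes the number of support constraints of $\mathrm{SP}_m[\omega_m]$. Non-Degeneracy: for every $m$, with probability one the solution of $\mathrm{SP}_m[\omega_m]$ coincides with the solution of the program defined by its support constraints only. $\zeta\le d$ is an integer such that, with probability one, the number of support constraints of $\mathrm{SP}_m[\omega_m]$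 is at most $\zeta$ for every $m$ (e.g. Helly's dimension or a tighter bound). The scenarios $\delta^{(1)},\dots,\delta^{(N)},\tilde\delta^{(1)},\dots,\tilde\delta^{(M)}$ are drawn from $\mathbb{P}^{N+M}$. $\mathbf{x}_N^*$ is the solution of the program $\mathrm{SP}_N$ built from $\delta^{(1)},\dots,\delta^{(N)}$, $s_N^*$ is its number of support constraints, and $r_M^*=\sum_{l=1}^M\mathbf{1}_{\{\delta: f(\mathbf{x}_N^*,\delta)>0\}}(\tilde\delta^{(l)})$ is the number of validation scenarios violated by $\mathbf{x}_N^*$. *)

theory Defs
  imports "HOL-Probability.Probability"
begin

definition lower_semicontinuous :: "('a::topological_space \<Rightarrow> real) \<Rightarrow> bool" where
  "lower_semicontinuous g \<longleftrightarrow> (\<forall>x. \<forall>c < g x. \<forall>\<^sub>F y in nhds x. c < g y)"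

text \<open>The space $(\Delta^m, \mathcal F^m, \mathbb P^m)$.\<close>

abbreviation samples :: "'b measure \<Rightarrow> nat \<Rightarrow> (nat \<Rightarrow> 'b) measure" where
  "samples P m \<equiv> Pi\<^sub>M {..<m} (\<lambda>_. P)"

text \<open>
  A multisample is a function \<open>\<omega>\<close> on indices, and the scenario constraints are labelled by their
  indices, so that repeated scenarios count as distinct constraints. The program with the constraints
  in the index set \<open>I\<close> is obtained from \<open>\<omega>\<close> and \<open>I\<close>: \<open>SP\<^sub>m[\<omega>]\<close> is the case \<open>I = {..<m}\<close>,
  and removing constraints shrinks \<open>I\<close>.
\<close>

definition scenario_feasible ::
  "'a set \<Rightarrow> ('a \<Rightarrow> 'b \<Rightarrow> real) \<Rightarrow> (nat \<Rightarrow> 'b) \<Rightarrow> nat set \<Rightarrow> 'a set" where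
  "scenario_feasible X f \<omega> I = {x \<in> X. \<forall>i\<in>I. f x (\<omega> i) \<le> 0}"

definition scenario_optimal ::
  "'a set \<Rightarrow> ('a \<Rightarrow> real) \<Rightarrow> ('a \<Rightarrow> 'b \<Rightarrow> real) \<Rightarrow> (nat \<Rightarrow> 'b) \<Rightarrow> nat set \<Rightarrow> 'a \<Rightarrow> bool" where
  "scenario_optimal X J f \<omega> I x \<longleftrightarrow>
     x \<in> scenario_feasible X f \<omega> I \<and> (\<forall>y \<in> scenario_feasible X f \<omega> I. J x \<le> J y)"

definition scenario_solution ::
  "'a set \<Rightarrow> ('a \<Rightarrow> real) \<Rightarrow> ('a \<Rightarrow> 'b \<Rightarrow> real) \<Rightarrow> (nat \<Rightarrow> 'b) \<Rightarrow> nat set \<Rightarrow> 'a" where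
  "scenario_solution X J f \<omega> I = (THE x. scenario_optimal X J f \<omega> I x)"

definition support_constraints ::
  "'a set \<Rightarrow> ('a \<Rightarrow> real) \<Rightarrow> ('a \<Rightarrow> 'b \<Rightarrow> real) \<Rightarrow> nat \<Rightarrow> (nat \<Rightarrow> 'b) \<Rightarrow> nat set" where
  "support_constraints X J f m \<omega> =
     {i \<in> {..<m}. scenario_solution X J f \<omega> ({..<m} - {i}) \<noteq> scenario_solution X J f \<omega> {..<m}}"

definition num_support ::
  "'a set \<Rightarrow> ('a \<Rightarrow> real) \<Rightarrow> ('a \<Rightarrow> 'b \<Rightarrow> real) \<Rightarrow> nat \<Rightarrow> (nat \<Rightarrow> 'b) \<Rightarrow> nat" where
  "num_support X J f m \<omega> = card (support_constraints X J f m \<omega>)"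

definition feasibility_uniqueness ::
  "'b measure \<Rightarrow> 'a set \<Rightarrow> ('a \<Rightarrow> real) \<Rightarrow> ('a \<Rightarrow> 'b \<Rightarrow> real) \<Rightarrow> bool" where
  "feasibility_uniqueness P X J f \<longleftrightarrow>
     (\<forall>m. \<forall>\<omega> \<in> space (samples P m). \<exists>!x. scenario_optimal X J f \<omega> {..<m} x)"

definition non_degenerate ::
  "'b measure \<Rightarrow> 'a set \<Rightarrow> ('a \<Rightarrow> real) \<Rightarrow> ('a \<Rightarrow> 'b \<Rightarrow> real) \<Rightarrow> bool" where
  "non_degenerate P X J f \<longleftrightarrow>
     (\<forall>m. AE \<omega> in samples P m.
        scenario_solution X J f \<omega> {..<m} =
        scenario_solution X J f \<omega> (support_constraints X J f m \<omega>))"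

definition violation_set :: "'b measure \<Rightarrow> ('a \<Rightarrow> 'b \<Rightarrow> real) \<Rightarrow> 'a \<Rightarrow> 'b set" where
  "violation_set P f x = {\<delta> \<in> space P. f x \<delta> > 0}"

definition violation_prob :: "'b measure \<Rightarrow> ('a \<Rightarrow> 'b \<Rightarrow> real) \<Rightarrow> 'a \<Rightarrow> real" where
  "violation_prob P f x = measure P (violation_set P f x)"

text \<open>
  The first conjunct makes \<open>V(x)\<close> well defined. The second says that the indicator of the event that
  one further scenario violates \<open>x\<^sub>m\<^sup>*\<close> is a random variable on $\Delta^m \times \Delta$. This
  already entails measurability of \<open>V(x\<^sub>m\<^sup>*)\<close>, of \<open>r\<^sub>M\<^sup>*\<close>, and of \<open>s\<^sub>m\<^sup>*\<close>, since the constraint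
  \<open>i\<close> is of support iff it is violated by the solution of the program without it.
\<close>

definition scenario_measurable ::
  "'b measure \<Rightarrow> 'a set \<Rightarrow> ('a \<Rightarrow> real) \<Rightarrow> ('a \<Rightarrow> 'b \<Rightarrow> real) \<Rightarrow> bool" where
  "scenario_measurable P X J f \<longleftrightarrow>
     (\<forall>x. violation_set P f x \<in> sets P) \<and>
     (\<forall>m. {(\<omega>, \<delta>) \<in> space (samples P m \<Otimes>\<^sub>M P). f (scenario_solution X J f \<omega> {..<m}) \<delta> > 0}
            \<in> sets (samples P m \<Otimes>\<^sub>M P))"

text \<open>
  In a multisample of length \<open>N + M\<close>, the first \<open>N\<close> entries are the design scenarios and the
  entries \<open>N, \<dots>, N + M - 1\<close> are the validation scenarios.
\<close>

definition num_violations ::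
  "'b measure \<Rightarrow> 'a set \<Rightarrow> ('a \<Rightarrow> real) \<Rightarrow> ('a \<Rightarrow> 'b \<Rightarrow> real) \<Rightarrow> nat \<Rightarrow> nat \<Rightarrow> (nat \<Rightarrow> 'b) \<Rightarrow> nat" where
  "num_violations P X J f N M \<omega> =
     (\<Sum>l<M. indicator (violation_set P f (scenario_solution X J f \<omega> {..<N})) (\<omega> (N + l)))"

definition binomial_cdf :: "nat \<Rightarrow> real \<Rightarrow> nat \<Rightarrow> real" where
  "binomial_cdf M t l = (\<Sum>i=0..l. real (M choose i) * t ^ i * (1 - t) ^ (M - i))"

definition h_poly ::
  "real \<Rightarrow> (nat \<Rightarrow> real) \<Rightarrow> nat \<Rightarrow> nat \<Rightarrow> nat \<Rightarrow> nat \<Rightarrow> real \<Rightarrow> real" where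
  "h_poly \<beta> a N M k l t =
     \<beta> * (\<Sum>m=k..N. a m * real (m choose k) * t ^ (m - k))
     - real (N choose k) * t ^ (N - k) * binomial_cdf M (1 - t) l"

definition t_root :: "real \<Rightarrow> (nat \<Rightarrow> real) \<Rightarrow> nat \<Rightarrow> nat \<Rightarrow> nat \<Rightarrow> nat \<Rightarrow> real" where
  "t_root \<beta> a N M k l = (THE t. t \<in> {0<..<1} \<and> h_poly \<beta> a N M k l t = 0)"

definition eps_bound :: "real \<Rightarrow> (nat \<Rightarrow> real) \<Rightarrow> nat \<Rightarrow> nat \<Rightarrow> nat \<Rightarrow> nat \<Rightarrow> real" where
  "eps_bound \<beta> a N M k l = 1 - t_root \<beta> a N M k l"

end

theory Submission
  imports Defs
begin

text \<open>
  The scenarios are exchangeable, and by non-degeneracy the event that the support constraints of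
  \<open>SP\<^sub>m\<close> are a given set \<open>I\<close> of size \<open>k\<close> is, up to a null set, the event that every constraint of
  the program on \<open>I\<close> is of support and its solution satisfies the other \<open>m - k\<close> scenarios. Writing
  \<open>F\<^sub>k\<close> for the law of \<open>V(x\<^sub>k\<^sup>*)\<close> on the event \<open>s\<^sub>k\<^sup>* = k\<close>, which does not depend on \<open>m\<close>, this gives
  \<open>P(s\<^sub>m\<^sup>* = k) = (m choose k) \<integral> (1 - v)^(m - k) dF\<^sub>k(v)\<close>, and for \<open>m = N\<close> the same formula with an
  arbitrary function of \<open>v\<close> under the integral. Given the design scenarios, \<open>r\<^sub>M\<^sup>*\<close> is binomial, so the
  probability in question is \<open>\<Sum>k. (N choose k) \<integral> (1 - v)^(N - k) B\<^sub>M(v; l(v)) dF\<^sub>k(v)\<close>, where \<open>l(v)\<close> is the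
  largest \<open>l\<close> with \<open>\<epsilon>(k, l) < v\<close>. As \<open>h(1 - v; k, l(v)) \<ge> 0\<close>, the integrand is at most
  \<open>\<beta> \<Sum>m. a\<^sub>m (m choose k) (1 - v)^(m - k)\<close>; integrating back yields \<open>\<beta> \<Sum>m. a\<^sub>m \<Sum>k. P(s\<^sub>m\<^sup>* = k) \<le> \<beta>\<close>.
\<close>

subsection \<open>The polynomials and their roots\<close>

text \<open>Pascal's rule, read as conditioning on one further trial that moves the count from
  \<open>i\<close> to \<open>Suc i\<close> with weight \<open>p\<close> and leaves it with weight
  \<open>q\<close>. It serves over \<open>real\<close> for the recursion of the distribution
  function and over \<open>ennreal\<close> for integrals, hence the semiring.\<close>

lemma binomial_sum_Suc:
  fixes p q :: "'a::comm_semiring_1"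
  shows "(\<Sum>i\<le>Suc M. of_nat (Suc M choose i) * p ^ i * q ^ (Suc M - i) * \<phi> i) =
    (\<Sum>i\<le>M. of_nat (M choose i) * p ^ i * q ^ (M - i) * (p * \<phi> (Suc i) + q * \<phi> i))"
proof -
  have "(\<Sum>i\<le>M. of_nat (M choose Suc i) * p ^ Suc i * q ^ (M - i) * \<phi> (Suc i)) + q ^ Suc M * \<phi> 0
      = (\<Sum>i\<le>Suc M. of_nat (M choose i) * p ^ i * q ^ (Suc M - i) * \<phi> i)"
    by (subst sum.atMost_Suc_shift) (simp add: add.commute)
  \<comment> \<open>The top term disappears because \<open>M choose Suc M = 0\<close>.\<close>
  also have "\<dots> = (\<Sum>i\<le>M. of_nat (M choose i) * p ^ i * q ^ (M - i) * (q * \<phi> i))"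
    by (auto simp: Suc_diff_le binomial_eq_0 algebra_simps intro!: sum.cong)
  finally have *: "(\<Sum>i\<le>M. of_nat (M choose Suc i) * p ^ Suc i * q ^ (M - i) * \<phi> (Suc i)) + q ^ Suc M * \<phi> 0
      = (\<Sum>i\<le>M. of_nat (M choose i) * p ^ i * q ^ (M - i) * (q * \<phi> i))" .
  have "(\<Sum>i\<le>Suc M. of_nat (Suc M choose i) * p ^ i * q ^ (Suc M - i) * \<phi> i) =
     (\<Sum>i\<le>M. of_nat (M choose i) * p ^ i * q ^ (M - i) * (p * \<phi> (Suc i))) +
     ((\<Sum>i\<le>M. of_nat (M choose Suc i) * p ^ Suc i * q ^ (M - i) * \<phi> (Suc i)) + q ^ Suc M * \<phi> 0)"
    by (subst sum.atMost_Suc_shift) (simp add: algebra_simps sum.distrib)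
  also have "\<dots> = (\<Sum>i\<le>M. of_nat (M choose i) * p ^ i * q ^ (M - i) * (p * \<phi> (Suc i) + q * \<phi> i))"
    unfolding * by (simp add: algebra_simps sum.distrib)
  finally show ?thesis .
qed

lemma binomial_cdf_0 [simp]: "binomial_cdf M t 0 = (1 - t) ^ M"
  by (simp add: binomial_cdf_def)

lemma binomial_cdf_at_0 [simp]: "binomial_cdf M 0 l = 1"
proof -
  have "binomial_cdf M 0 l = (\<Sum>i=0..l. if i = 0 then 1 else 0)"
    unfolding binomial_cdf_def by (intro sum.cong) auto
  then show ?thesis by simp
qed

lemma binomial_cdf_no_trials [simp]: "binomial_cdf 0 t l = 1"
proof -
  have "binomial_cdf 0 t l = (\<Sum>i=0..l. if i = 0 then 1 else 0)"
    unfolding binomial_cdf_def by (intro sum.cong) (auto simp: binomial_eq_0)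
  then show ?thesis by simp
qed

lemma binomial_cdf_Suc_Suc:
  "binomial_cdf (Suc M) t (Suc l) = t * binomial_cdf M t l + (1 - t) * binomial_cdf M t (Suc l)"
proof -
  \<comment> \<open>The cutoff at \<open>l\<close> becomes a weight, so that the sum can run up to
    \<open>M\<close> and \<open>binomial_sum_Suc\<close> applies. The range up to
    \<open>M + l\<close> contains both the range up to \<open>l\<close> and the range up to
    \<open>M\<close>.\<close>
  define B where "B M l = (\<Sum>i\<le>M + l. real (M choose i) * t ^ i * (1 - t) ^ (M - i) * (if i \<le> l then 1 else 0))"
    for M l
  have B: "binomial_cdf M t l = B M l" for M l
    unfolding B_def binomial_cdf_def
    by (rule sum.mono_neutral_cong_left) auto
  have B': "B M l = (\<Sum>i\<le>M. real (M choose i) * t ^ i * (1 - t) ^ (M - i) * (if i \<le> l then 1 else 0))" for M l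
    unfolding B_def by (rule sum.mono_neutral_right) (auto simp: binomial_eq_0)
  show ?thesis
    unfolding B B' using binomial_sum_Suc[of M t "1 - t" "\<lambda>i. if i \<le> Suc l then 1 else 0"]
    by (simp add: sum_distrib_left sum.distrib[symmetric] algebra_simps)
qed

lemma binomial_cdf_Suc_bound:
  "binomial_cdf M t (Suc l) = binomial_cdf M t l + real (M choose Suc l) * t ^ Suc l * (1 - t) ^ (M - Suc l)"
  by (simp add: binomial_cdf_def)

text \<open>Induction through the one-trial recursion: lowering the success probability first shifts
  weight from the value at \<open>l'\<close> to the larger value at \<open>Suc l'\<close>, and then
  the induction hypothesis raises both values.\<close>

lemma binomial_cdf_antimono:
  assumes "0 \<le> p" "p \<le> q" "q \<le> 1"
  shows "binomial_cdf M q l \<le> binomial_cdf M p l"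
proof (induction M arbitrary: l)
  case (Suc M)
  show ?case
  proof (cases l)
    case 0
    then show ?thesis using assms by (auto intro!: power_mono simp del: power_Suc)
  next
    case (Suc l')
    have "0 \<le> (q - p) * (binomial_cdf M q (Suc l') - binomial_cdf M q l')"
      using assms by (simp add: binomial_cdf_Suc_bound)
    then have "q * binomial_cdf M q l' + (1 - q) * binomial_cdf M q (Suc l')
        \<le> p * binomial_cdf M q l' + (1 - p) * binomial_cdf M q (Suc l')"
      by (simp add: algebra_simps)
    also have "\<dots> \<le> p * binomial_cdf M p l' + (1 - p) * binomial_cdf M p (Suc l')"
      using assms by (intro add_mono mult_left_mono Suc.IH) auto
    finally show ?thesis by (simp add: Suc binomial_cdf_Suc_Suc)
  qed
qed simp

section \<open>Signs and roots of the polynomials h\<close>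

locale validation_polynomials =
  fixes \<beta> :: real and a :: "nat \<Rightarrow> real" and \<zeta> N :: nat
  assumes beta: "0 < \<beta>" "\<beta> < 1"
    and a_nonneg: "\<And>m. m \<le> N \<Longrightarrow> a m \<ge> 0"
    and a_pos: "(\<Sum>m=\<zeta>..N-1. a m) > 0"
    and a_sum: "(\<Sum>m=0..N. a m) = 1"
    and zeta_less: "\<zeta> < N"
begin

text \<open>Since \<open>m < N\<close>, this coefficient belongs to a power below
  \<open>t ^ (N - k)\<close>, the source of strictness and of positivity near 0;
  \<open>\<zeta> \<le> m\<close> makes it occur for every \<open>k \<le> \<zeta>\<close>.\<close>

lemma obtain_positive_coeff:
  obtains m where "\<zeta> \<le> m" "m < N" "0 < a m"
proof -
  from a_pos obtain m where "m \<in> {\<zeta>..N-1}" "0 < a m"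
    by (metis not_le sum_nonpos)
  then show thesis using zeta_less that[of m] by auto
qed

text \<open>In other words, \<open>h t / t ^ (N - k)\<close> is strictly decreasing on \<open>(0, 1]\<close>.\<close>

lemma h_poly_cross:
  assumes k: "k \<le> \<zeta>" and st: "0 < s" "s < t" "t \<le> 1"
  shows "h_poly \<beta> a N M k l t * s ^ (N - k) < h_poly \<beta> a N M k l s * t ^ (N - k)"
proof -
  obtain m0 where m0: "\<zeta> \<le> m0" "m0 < N" "0 < a m0" by (rule obtain_positive_coeff)
  \<comment> \<open>With the common factor \<open>(s * t) ^ (m - k)\<close> extracted, only
    \<open>s ^ (N - m)\<close> and \<open>t ^ (N - m)\<close> remain to be compared.\<close>
  have split: "u ^ (m - k) * w ^ (N - k) = (u * w) ^ (m - k) * w ^ (N - m)"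
    if "k \<le> m" "m \<le> N" for u w :: real and m
  proof -
    have "N - k = (m - k) + (N - m)" using that by simp
    then show ?thesis by (simp add: power_add power_mult_distrib)
  qed
  have le: "t ^ (m - k) * s ^ (N - k) \<le> s ^ (m - k) * t ^ (N - k)" if "k \<le> m" "m \<le> N" for m
    unfolding split[OF that] using st by (auto intro!: mult_mono power_mono simp: mult.commute)
  have less: "t ^ (m0 - k) * s ^ (N - k) < s ^ (m0 - k) * t ^ (N - k)"
  proof -
    have "s ^ (N - m0) < t ^ (N - m0)" using st m0 by (intro power_strict_mono) auto
    then show ?thesis using split[of m0 t s] split[of m0 s t] k m0 st
      by (simp add: mult.commute)
  qed
  have "(\<Sum>m=k..N. a m * real (m choose k) * (t ^ (m - k) * s ^ (N - k)))
      < (\<Sum>m=k..N. a m * real (m choose k) * (s ^ (m - k) * t ^ (N - k)))"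
  proof (rule sum_strict_mono_ex1)
    show "\<forall>m\<in>{k..N}. a m * real (m choose k) * (t ^ (m - k) * s ^ (N - k))
        \<le> a m * real (m choose k) * (s ^ (m - k) * t ^ (N - k))"
      using le a_nonneg by (auto intro!: mult_left_mono)
    show "\<exists>m\<in>{k..N}. a m * real (m choose k) * (t ^ (m - k) * s ^ (N - k))
        < a m * real (m choose k) * (s ^ (m - k) * t ^ (N - k))"
      using m0 k less by (intro bexI[of _ m0] mult_strict_left_mono) auto
  qed simp
  then have 1: "\<beta> * (\<Sum>m=k..N. a m * real (m choose k) * t ^ (m - k)) * s ^ (N - k)
      < \<beta> * (\<Sum>m=k..N. a m * real (m choose k) * s ^ (m - k)) * t ^ (N - k)"
    using beta by (simp add: sum_distrib_right mult.assoc)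
  have 2: "real (N choose k) * s ^ (N - k) * t ^ (N - k) * binomial_cdf M (1 - s) l
      \<le> real (N choose k) * s ^ (N - k) * t ^ (N - k) * binomial_cdf M (1 - t) l"
    using st by (intro mult_left_mono binomial_cdf_antimono) auto
  show ?thesis
    unfolding h_poly_def using 1 2 by (simp add: algebra_simps)
qed

text \<open>At 1 the distribution function equals 1, while the weighted sum is at most
  \<open>N choose k\<close>, as the weights add up to at most 1; the factor
  \<open>\<beta> < 1\<close> does the rest.\<close>

lemma h_poly_at_1_neg:
  assumes "k \<le> \<zeta>"
  shows "h_poly \<beta> a N M k l 1 < 0"
proof -
  have "(\<Sum>m=k..N. a m * real (m choose k)) \<le> (\<Sum>m=k..N. a m * real (N choose k))"
    using a_nonneg by (intro sum_mono mult_left_mono) (auto intro: binomial_right_mono)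
  also have "\<dots> \<le> (\<Sum>m=0..N. a m * real (N choose k))"
    using a_nonneg by (intro sum_mono2) auto
  also have "\<dots> = real (N choose k)"
    by (simp add: a_sum flip: sum_distrib_right)
  finally have "\<beta> * (\<Sum>m=k..N. a m * real (m choose k)) \<le> \<beta> * real (N choose k)"
    using beta by simp
  also have "\<dots> < real (N choose k)"
    using beta assms zeta_less by simp
  finally show ?thesis by (simp add: h_poly_def)
qed

text \<open>The term of order \<open>s ^ (m0 - k)\<close> with positive coefficient dominates the
  subtracted one, which is of the higher order \<open>s ^ (N - k)\<close>.\<close>

lemma h_poly_pos_near_0:
  assumes k: "k \<le> \<zeta>"
  obtains s where "0 < s" "s < 1" "0 < h_poly \<beta> a N M k l s"
proof -
  obtain m0 where m0: "\<zeta> \<le> m0" "m0 < N" "0 < a m0" by (rule obtain_positive_coeff)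
  define c where "c = \<beta> * (a m0 * real (m0 choose k))"
  define C where "C = real (N choose k)"
  have c: "0 < c" and C: "0 < C"
    using beta m0 k by (auto simp: c_def C_def)
  \<comment> \<open>Chosen so that \<open>C * s \<le> c / 2 < c\<close>, with \<open>1/2\<close>
    keeping \<open>s\<close> below 1.\<close>
  define s where "s = min (1/2) (c / (2 * C))"
  have s: "0 < s" "s < 1" using c C by (auto simp: s_def)
  have "C * s \<le> c / 2"
  proof -
    have "C * s \<le> C * (c / (2 * C))" using C by (intro mult_left_mono) (auto simp: s_def)
    then show ?thesis using C by simp
  qed
  have "s ^ (N - m0) \<le> s ^ 1"
    using s m0 by (intro power_decreasing) auto
  then have "C * s ^ (N - m0) \<le> C * s" using C by simp
  with \<open>C * s \<le> c / 2\<close> c have *: "C * s ^ (N - m0) < c" by linarith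
  have "N - k = (m0 - k) + (N - m0)" using m0 k by simp
  then have "C * s ^ (N - k) = s ^ (m0 - k) * (C * s ^ (N - m0))" by (simp add: power_add)
  also have "\<dots> < s ^ (m0 - k) * c" using * s by simp
  finally have 1: "C * s ^ (N - k) < s ^ (m0 - k) * c" .
  have "binomial_cdf M (1 - s) l \<le> binomial_cdf M 0 l"
    using s by (intro binomial_cdf_antimono) auto
  then have 2: "C * s ^ (N - k) * binomial_cdf M (1 - s) l \<le> C * s ^ (N - k) * 1"
    using C s by (intro mult_left_mono) auto
  have "a m0 * real (m0 choose k) * s ^ (m0 - k) \<le> (\<Sum>m=k..N. a m * real (m choose k) * s ^ (m - k))"
    using m0 k a_nonneg s by (intro member_le_sum) auto
  then have 3: "s ^ (m0 - k) * c \<le> \<beta> * (\<Sum>m=k..N. a m * real (m choose k) * s ^ (m - k))"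
    using beta unfolding c_def by (simp add: mult_ac)
  from 1 2 3 have "0 < h_poly \<beta> a N M k l s" unfolding h_poly_def C_def by linarith
  with s that show thesis by blast
qed

lemma continuous_on_h_poly: "continuous_on A (h_poly \<beta> a N M k l)"
  unfolding h_poly_def binomial_cdf_def by (intro continuous_intros)

text \<open>Existence is the intermediate value theorem between a positive value near 0 and the
  negative value at 1. Two roots would turn the strict inequality of \<open>h_poly_cross\<close>
  into \<open>0 < 0\<close>.\<close>

lemma h_poly_root_ex1:
  assumes k: "k \<le> \<zeta>"
  shows "\<exists>!t. t \<in> {0<..<1} \<and> h_poly \<beta> a N M k l t = 0"
proof -
  obtain s where s: "0 < s" "s < 1" "0 < h_poly \<beta> a N M k l s"
    using h_poly_pos_near_0[OF k] by blast
  have "\<exists>t\<ge>s. t \<le> 1 \<and> h_poly \<beta> a N M k l t = 0"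
    using s h_poly_at_1_neg[OF k] by (intro IVT2' continuous_on_h_poly) (auto intro: less_imp_le)
  then obtain t where t: "s \<le> t" "t \<le> 1" "h_poly \<beta> a N M k l t = 0" by blast
  have "t \<noteq> 1" using t h_poly_at_1_neg[OF k, of M l] by auto
  have uniq: "\<not> u < v" if "u \<in> {0<..<1}" "h_poly \<beta> a N M k l u = 0" "v \<in> {0<..<1}" "h_poly \<beta> a N M k l v = 0"
    for u v
    using h_poly_cross[OF k, of u v M l] that by auto
  show ?thesis
  proof (rule ex1I[of _ t])
    show "t \<in> {0<..<1} \<and> h_poly \<beta> a N M k l t = 0" using s t \<open>t \<noteq> 1\<close> by auto
    then show "u = t" if "u \<in> {0<..<1} \<and> h_poly \<beta> a N M k l u = 0" for u
      using uniq[of u t] uniq[of t u] that by force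
  qed
qed

lemma t_root:
  assumes "k \<le> \<zeta>"
  shows "0 < t_root \<beta> a N M k l" "t_root \<beta> a N M k l < 1" "h_poly \<beta> a N M k l (t_root \<beta> a N M k l) = 0"
  using theI'[OF h_poly_root_ex1[OF assms, of M l]] unfolding t_root_def by auto

text \<open>Compare with the root by \<open>h_poly_cross\<close>. That needs a positive argument, so
  0 is separate: there the subtracted term vanishes as \<open>k < N\<close>, and only the weak
  inequality survives because \<open>a k\<close> may be 0.\<close>

lemma h_poly_nonneg_left:
  assumes k: "k \<le> \<zeta>" and t: "0 \<le> t" "t < t_root \<beta> a N M k l"
  shows "0 \<le> h_poly \<beta> a N M k l t"
proof (cases "t = 0")
  case True
  have "0 \<le> \<beta> * (\<Sum>m=k..N. a m * real (m choose k) * 0 ^ (m - k))"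
    using a_nonneg beta by (intro mult_nonneg_nonneg sum_nonneg) auto
  then show ?thesis
    using True k zeta_less by (simp add: h_poly_def zero_power)
next
  case False
  then have "0 < h_poly \<beta> a N M k l t * t_root \<beta> a N M k l ^ (N - k)"
    using h_poly_cross[OF k, of t "t_root \<beta> a N M k l" M l] t t_root[OF k, of M l] by auto
  then show ?thesis
    using t_root[OF k, of M l] by (simp add: zero_less_mult_iff)
qed

text \<open>Passing from \<open>l\<close> to \<open>l + 1\<close> subtracts a positive term, so the
  polynomial for \<open>l + 1\<close> is negative at the root for \<open>l\<close>, which must
  therefore lie to the right of the new root.\<close>

lemma t_root_strict_antimono:
  assumes k: "k \<le> \<zeta>" and l: "l < M"
  shows "t_root \<beta> a N M k (l + 1) < t_root \<beta> a N M k l"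
proof (rule ccontr)
  let ?t = "t_root \<beta> a N M k l" and ?u = "t_root \<beta> a N M k (l + 1)"
  note t = t_root[OF k, of M l] and u = t_root[OF k, of M "l + 1"]
  assume "\<not> ?u < ?t"
  then have "?t \<le> ?u" by simp
  have "h_poly \<beta> a N M k (l + 1) ?t = - (real (N choose k) * ?t ^ (N - k) *
      (real (M choose Suc l) * (1 - ?t) ^ Suc l * ?t ^ (M - Suc l)))"
    using t(3) by (simp add: h_poly_def binomial_cdf_Suc_bound algebra_simps)
  also have "\<dots> < 0"
    using t k l zeta_less by (auto intro!: mult_pos_pos)
  finally have "h_poly \<beta> a N M k (l + 1) ?t < 0" .
  moreover have "0 \<le> h_poly \<beta> a N M k (l + 1) ?t"
    using \<open>?t \<le> ?u\<close> u t h_poly_nonneg_left[OF k, of ?t M "l + 1"] by fastforce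
  ultimately show False by simp
qed

text \<open>The pointwise estimate to be integrated over \<open>v\<close>. The left-hand sum is the
  probability that a binomial count with success probability \<open>v\<close> falls where the bound
  is below \<open>v\<close>.\<close>

lemma binomial_tail_bound:
  assumes k: "k \<le> \<zeta>" and v: "0 \<le> v" "v \<le> 1"
  shows "real (N choose k) * (1 - v) ^ (N - k) *
      (\<Sum>l\<le>M. real (M choose l) * v ^ l * (1 - v) ^ (M - l) * (if eps_bound \<beta> a N M k l < v then 1 else 0))
    \<le> \<beta> * (\<Sum>m=k..N. a m * real (m choose k) * (1 - v) ^ (m - k))"
proof -
  define L where "L = {l. l \<le> M \<and> eps_bound \<beta> a N M k l < v}"
  have "finite L" unfolding L_def by (rule finite_subset[of _ "{..M}"]) auto
  have sum_L: "(\<Sum>l\<le>M. real (M choose l) * v ^ l * (1 - v) ^ (M - l) * (if eps_bound \<beta> a N M k l < v then 1 else 0))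
    = (\<Sum>l\<in>L. real (M choose l) * v ^ l * (1 - v) ^ (M - l))"
    by (rule sum.mono_neutral_cong_right) (auto simp: L_def)
  show ?thesis
  proof (cases "L = {}")
    case True
    have "0 \<le> \<beta> * (\<Sum>m=k..N. a m * real (m choose k) * (1 - v) ^ (m - k))"
      using beta a_nonneg v by (intro mult_nonneg_nonneg sum_nonneg) auto
    then show ?thesis unfolding sum_L True by simp
  next
    case False
    then have "Max L \<in> L" using \<open>finite L\<close> by (rule Max_in[rotated])
    \<comment> \<open>Exceeding the bound at \<open>Max L\<close> means lying left of its root,
      where h is nonnegative; enlarging \<open>L\<close> to all indices up to \<open>Max L\<close>
      then produces exactly the distribution function in h.\<close>
    then have "1 - v < t_root \<beta> a N M k (Max L)" by (auto simp: L_def eps_bound_def)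
    then have h: "0 \<le> h_poly \<beta> a N M k (Max L) (1 - v)"
      using v by (intro h_poly_nonneg_left k) auto
    have "(\<Sum>l\<in>L. real (M choose l) * v ^ l * (1 - v) ^ (M - l)) \<le> binomial_cdf M v (Max L)"
      unfolding binomial_cdf_def using \<open>finite L\<close> v by (intro sum_mono2) auto
    then have "real (N choose k) * (1 - v) ^ (N - k) * (\<Sum>l\<in>L. real (M choose l) * v ^ l * (1 - v) ^ (M - l))
      \<le> real (N choose k) * (1 - v) ^ (N - k) * binomial_cdf M v (Max L)"
      using v by (intro mult_left_mono) auto
    also have "\<dots> \<le> \<beta> * (\<Sum>m=k..N. a m * real (m choose k) * (1 - v) ^ (m - k))"
      using h unfolding h_poly_def by simp
    finally show ?thesis unfolding sum_L .
  qed
qed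

end

subsection \<open>Scenario programs\<close>

text \<open>The source of exchangeability: labels and multiplicities of the imposed scenarios are
  irrelevant, so programs can be renumbered freely.\<close>

lemma scenario_feasible_cong:
  assumes "\<omega> ` I = \<omega>' ` I'"
  shows "scenario_feasible X f \<omega> I = scenario_feasible X f \<omega>' I'"
proof -
  have "scenario_feasible X f \<omega> I = {x \<in> X. \<forall>\<delta>\<in>\<omega> ` I. f x \<delta> \<le> 0}" for \<omega> :: "nat \<Rightarrow> _" and I
    by (simp add: scenario_feasible_def)
  then show ?thesis by (simp only: assms)
qed

lemma scenario_optimal_cong:
  "\<omega> ` I = \<omega>' ` I' \<Longrightarrow> scenario_optimal X J f \<omega> I = scenario_optimal X J f \<omega>' I'"
  unfolding scenario_optimal_def fun_eq_iff by (simp add: scenario_feasible_cong[of \<omega> I \<omega>' I'])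

lemma scenario_solution_cong:
  "\<omega> ` I = \<omega>' ` I' \<Longrightarrow> scenario_solution X J f \<omega> I = scenario_solution X J f \<omega>' I'"
  unfolding scenario_solution_def by (simp add: scenario_optimal_cong[of \<omega> I \<omega>' I'])

lemma num_support_cong:
  assumes "\<And>i. i < m \<Longrightarrow> \<omega> i = \<omega>' i"
  shows "num_support X J f m \<omega> = num_support X J f m \<omega>'"
proof -
  have "scenario_solution X J f \<omega> I = scenario_solution X J f \<omega>' I" if "I \<subseteq> {..<m}" for I
    using assms that by (intro scenario_solution_cong image_cong) auto
  then show ?thesis
    unfolding num_support_def support_constraints_def by simp
qed

locale scenario_program = prob_space P
  for P :: "'b measure" +
  fixes X :: "'a set" and J :: "'a \<Rightarrow> real" and f :: "'a \<Rightarrow> 'b \<Rightarrow> real"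
  assumes feasibility_uniqueness: "feasibility_uniqueness P X J f"
    and scenario_measurable: "scenario_measurable P X J f"
    and non_degenerate: "non_degenerate P X J f"
begin

sublocale samples: product_prob_space "\<lambda>_::nat. P" UNIV
  by unfold_locales

abbreviation sol :: "(nat \<Rightarrow> 'b) \<Rightarrow> nat set \<Rightarrow> 'a" where
  "sol \<equiv> scenario_solution X J f"

abbreviation V :: "nat \<Rightarrow> (nat \<Rightarrow> 'b) \<Rightarrow> real" where
  "V m \<omega> \<equiv> violation_prob P f (sol \<omega> {..<m})"

text \<open>It looks only at the scenarios in \<open>I\<close>, so that those outside
  \<open>I\<close> stay independent of it.\<close>

definition all_support :: "(nat \<Rightarrow> 'b) \<Rightarrow> nat set \<Rightarrow> bool" where
  "all_support \<omega> I \<longleftrightarrow> (\<forall>i\<in>I. sol \<omega> (I - {i}) \<noteq> sol \<omega> I)"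

text \<open>The assumption covers the index sets \<open>{..<m}\<close> only; a bijection from
  \<open>{..<card I}\<close> renumbers \<open>I\<close>.\<close>

lemma optimal_ex1:
  assumes "finite I" "\<omega> ` I \<subseteq> space P"
  shows "\<exists>!x. scenario_optimal X J f \<omega> I x"
proof -
  obtain h where h: "bij_betw h {..<card I} I"
    using \<open>finite I\<close> by (metis atLeast0LessThan ex_bij_betw_nat_finite)
  define \<omega>' where "\<omega>' = (\<lambda>i\<in>{..<card I}. \<omega> (h i))"
  have "\<omega>' ` {..<card I} = \<omega> ` (h ` {..<card I})"
    unfolding \<omega>'_def by (auto simp: image_image)
  then have "\<omega>' ` {..<card I} = \<omega> ` I"
    using h by (simp add: bij_betw_def)
  moreover from this have "\<omega>' \<in> space (samples P (card I))"
    using assms by (auto simp: space_PiM \<omega>'_def)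
  ultimately show ?thesis
    using feasibility_uniqueness scenario_optimal_cong[of \<omega>' "{..<card I}" \<omega> I]
    unfolding feasibility_uniqueness_def by metis
qed

lemma optimal_sol:
  "finite I \<Longrightarrow> \<omega> ` I \<subseteq> space P \<Longrightarrow> scenario_optimal X J f \<omega> I (sol \<omega> I)"
  unfolding scenario_solution_def by (rule theI') (rule optimal_ex1)

lemma sol_eqI:
  "finite I \<Longrightarrow> \<omega> ` I \<subseteq> space P \<Longrightarrow> scenario_optimal X J f \<omega> I x \<Longrightarrow> sol \<omega> I = x"
  by (metis optimal_ex1 optimal_sol)

text \<open>An optimum that satisfies the added constraints stays optimal in the smaller feasible
  set, and optima are unique.\<close>

lemma sol_superset_eq:
  assumes "finite I'" "\<omega> ` I' \<subseteq> space P" "I \<subseteq> I'"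
    and "\<And>j. j \<in> I' - I \<Longrightarrow> f (sol \<omega> I) (\<omega> j) \<le> 0"
  shows "sol \<omega> I' = sol \<omega> I"
proof (rule sol_eqI[OF assms(1,2)])
  have "scenario_optimal X J f \<omega> I (sol \<omega> I)"
    using assms(1-3) by (intro optimal_sol) (auto intro: finite_subset)
  then show "scenario_optimal X J f \<omega> I' (sol \<omega> I)"
    using assms(3,4) unfolding scenario_optimal_def scenario_feasible_def by blast
qed

lemma sol_satisfies:
  "finite I \<Longrightarrow> \<omega> ` I \<subseteq> space P \<Longrightarrow> j \<in> I \<Longrightarrow> f (sol \<omega> I) (\<omega> j) \<le> 0"
  using optimal_sol[of I \<omega>] unfolding scenario_optimal_def scenario_feasible_def by blast

lemma sol_intermediate_eq:
  assumes "finite K" "\<omega> ` K \<subseteq> space P" "I \<subseteq> I'" "I' \<subseteq> K" "sol \<omega> I = sol \<omega> K"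
  shows "sol \<omega> I' = sol \<omega> I"
  using assms sol_satisfies[of K \<omega>]
  by (intro sol_superset_eq) (auto intro: finite_subset)

text \<open>Turns support into violation by a solution that does not involve scenario
  \<open>i\<close>, an event whose measurability is available.\<close>

lemma sol_remove_neq_iff:
  assumes "finite I" "\<omega> ` I \<subseteq> space P" "i \<in> I"
  shows "sol \<omega> (I - {i}) \<noteq> sol \<omega> I \<longleftrightarrow> 0 < f (sol \<omega> (I - {i})) (\<omega> i)"
proof
  assume "sol \<omega> (I - {i}) \<noteq> sol \<omega> I"
  then show "0 < f (sol \<omega> (I - {i})) (\<omega> i)"
    using sol_superset_eq[of I \<omega> "I - {i}"] assms by force
next
  assume "0 < f (sol \<omega> (I - {i})) (\<omega> i)"
  then show "sol \<omega> (I - {i}) \<noteq> sol \<omega> I"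
    using sol_satisfies[of I \<omega> i] assms by force
qed

text \<open>Separates a condition on the scenarios in \<open>I\<close> alone from the requirement
  that the others be satisfied by the solution on \<open>I\<close>.\<close>

lemma support_constraints_eq_iff:
  assumes \<omega>: "\<omega> ` {..<m} \<subseteq> space P"
    and nd: "sol \<omega> {..<m} = sol \<omega> (support_constraints X J f m \<omega>)"
    and I: "I \<subseteq> {..<m}"
  shows "support_constraints X J f m \<omega> = I \<longleftrightarrow>
    all_support \<omega> I \<and> (\<forall>j\<in>{..<m} - I. f (sol \<omega> I) (\<omega> j) \<le> 0)"
proof
  let ?S = "support_constraints X J f m \<omega>"
  assume S: "?S = I"
  have "sol \<omega> (I - {i}) \<noteq> sol \<omega> I" if i: "i \<in> I" for i
  proof
    \<comment> \<open>Then \<open>I - {i}\<close> already determines the full solution, hence so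
      does the larger \<open>{..<m} - {i}\<close>, and \<open>i\<close> is not of support.\<close>
    assume "sol \<omega> (I - {i}) = sol \<omega> I"
    then have "sol \<omega> ({..<m} - {i}) = sol \<omega> {..<m}"
      using sol_intermediate_eq[of "{..<m}" \<omega> "I - {i}" "{..<m} - {i}"] I \<omega> nd S by auto
    then show False using i S unfolding support_constraints_def by auto
  qed
  moreover have "f (sol \<omega> I) (\<omega> j) \<le> 0" if "j \<in> {..<m} - I" for j
    using sol_satisfies[of "{..<m}" \<omega> j] that \<omega> nd S by auto
  ultimately show "all_support \<omega> I \<and> (\<forall>j\<in>{..<m} - I. f (sol \<omega> I) (\<omega> j) \<le> 0)"
    unfolding all_support_def by blast
next
  let ?S = "support_constraints X J f m \<omega>"
  assume R: "all_support \<omega> I \<and> (\<forall>j\<in>{..<m} - I. f (sol \<omega> I) (\<omega> j) \<le> 0)"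
  have eq: "sol \<omega> {..<m} = sol \<omega> I"
    using R \<omega> I by (intro sol_superset_eq) auto
  have "?S \<subseteq> I"
  proof
    fix i assume i: "i \<in> ?S"
    show "i \<in> I"
    proof (rule ccontr)
      assume "i \<notin> I"
      then have "sol \<omega> ({..<m} - {i}) = sol \<omega> I"
        using sol_intermediate_eq[of "{..<m}" \<omega> I "{..<m} - {i}"] I \<omega> eq by auto
      then show False using i eq unfolding support_constraints_def by auto
    qed
  qed
  \<comment> \<open>By non-degeneracy \<open>?S\<close> determines the full solution. If
    \<open>?S\<close> missed \<open>i\<close>, so would \<open>I - {i}\<close>, which lies between
    \<open>?S\<close> and \<open>{..<m}\<close>, contradicting \<open>all_support\<close>.\<close>
  moreover have "i \<in> ?S" if i: "i \<in> I" for i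
  proof (rule ccontr)
    assume "i \<notin> ?S"
    with \<open>?S \<subseteq> I\<close> have "sol \<omega> (I - {i}) = sol \<omega> ?S"
      using sol_intermediate_eq[of "{..<m}" \<omega> ?S "I - {i}"] I \<omega> nd by auto
    then show False using R i eq nd unfolding all_support_def by auto
  qed
  ultimately show "?S = I" by blast
qed

section \<open>Measurability\<close>

lemma sets_violation_set [measurable]: "violation_set P f x \<in> sets P"
  using scenario_measurable unfolding scenario_measurable_def by blast

lemma pred_violates [measurable]:
  "Measurable.pred (samples P m \<Otimes>\<^sub>M P) (\<lambda>(\<omega>, \<delta>). 0 < f (sol \<omega> {..<m}) \<delta>)"
proof -
  have "{z \<in> space (samples P m \<Otimes>\<^sub>M P). case z of (\<omega>, \<delta>) \<Rightarrow> 0 < f (sol \<omega> {..<m}) \<delta>} \<in> sets (samples P m \<Otimes>\<^sub>M P)"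
    using scenario_measurable unfolding scenario_measurable_def
    by (auto simp: case_prod_beta' Collect_conj_eq2[symmetric] elim!: allE[of _ m])
  then show ?thesis by (simp add: pred_def)
qed

lemma V_bounds [simp]: "0 \<le> V m \<omega>" "V m \<omega> \<le> 1"
  by (simp_all add: violation_prob_def)

lemma space_samples_image: "\<omega> \<in> space (samples P n) \<Longrightarrow> I \<subseteq> {..<n} \<Longrightarrow> \<omega> ` I \<subseteq> space P"
  by (auto simp: space_PiM)

lemma sol_restrict: "I \<subseteq> {..<m} \<Longrightarrow> sol (restrict \<omega> {..<m}) I = sol \<omega> I"
  by (intro scenario_solution_cong image_cong) auto

text \<open>The assumed measurability concerns a solution on \<open>{..<m}\<close> and one separate
  scenario; selecting the coordinates \<open>h j\<close> and \<open>i\<close> is a measurable map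
  that pulls it back.\<close>

lemma pred_violates_reindexed:
  fixes m n :: nat and h :: "nat \<Rightarrow> nat"
  assumes h: "\<And>j. j < m \<Longrightarrow> h j < n" and i: "i < n"
  shows "Measurable.pred (samples P n) (\<lambda>\<omega>. 0 < f (sol \<omega> (h ` {..<m})) (\<omega> i))"
proof -
  have [measurable]: "(\<lambda>\<omega>. \<omega> j) \<in> measurable (samples P n) P" if "j < n" for j
    using that by (intro measurable_component_singleton) auto
  have "(\<lambda>\<omega>. (\<lambda>j\<in>{..<m}. \<omega> (h j), \<omega> i)) \<in> measurable (samples P n) (samples P m \<Otimes>\<^sub>M P)"
    using h i by (intro measurable_Pair measurable_restrict) auto
  from measurable_compose[OF this pred_violates]
  have "Measurable.pred (samples P n) (\<lambda>\<omega>. 0 < f (sol (\<lambda>j\<in>{..<m}. \<omega> (h j)) {..<m}) (\<omega> i))"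
    by simp
  moreover have "sol (\<lambda>j\<in>{..<m}. \<omega> (h j)) {..<m} = sol \<omega> (h ` {..<m})" for \<omega>
    by (intro scenario_solution_cong) (auto simp: image_image)
  ultimately show ?thesis by simp
qed

lemma pred_violates_index:
  assumes I: "I \<subseteq> {..<n}" and i: "i < n"
  shows "Measurable.pred (samples P n) (\<lambda>\<omega>. 0 < f (sol \<omega> I) (\<omega> i))"
proof -
  have "finite I" using I finite_subset by blast
  then obtain h where h: "bij_betw h {..<card I} I"
    by (metis atLeast0LessThan ex_bij_betw_nat_finite)
  then show ?thesis
    using pred_violates_reindexed[of "card I" h n i] I i by (force simp: bij_betw_def)
qed

lemma measurable_V [measurable]: "V m \<in> borel_measurable (samples P m)"
proof -
  let ?Q = "{z \<in> space (samples P m \<Otimes>\<^sub>M P). case z of (\<omega>, \<delta>) \<Rightarrow> 0 < f (sol \<omega> {..<m}) \<delta>}"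
  have "(\<lambda>\<omega>. emeasure P (Pair \<omega> -` ?Q)) \<in> borel_measurable (samples P m)"
    by (rule measurable_emeasure_Pair) measurable
  then have "(\<lambda>\<omega>. measure P (Pair \<omega> -` ?Q)) \<in> borel_measurable (samples P m)"
    unfolding measure_def by measurable
  moreover have "measure P (Pair \<omega> -` ?Q) = V m \<omega>" if "\<omega> \<in> space (samples P m)" for \<omega>
    using that unfolding violation_prob_def violation_set_def
    by (intro arg_cong[where f = "measure P"]) (auto simp: space_pair_measure)
  ultimately show ?thesis by (simp cong: measurable_cong)
qed

lemma pred_support:
  assumes "i < m"
  shows "Measurable.pred (samples P m) (\<lambda>\<omega>. sol \<omega> ({..<m} - {i}) \<noteq> sol \<omega> {..<m})"
proof -
  have "Measurable.pred (samples P m) (\<lambda>\<omega>. 0 < f (sol \<omega> ({..<m} - {i})) (\<omega> i))"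
    using assms by (intro pred_violates_index) auto
  then show ?thesis
    using sol_remove_neq_iff[of "{..<m}" _ i] assms space_samples_image[of _ m "{..<m}"]
    by (subst measurable_cong[of _ _ "\<lambda>\<omega>. 0 < f (sol \<omega> ({..<m} - {i})) (\<omega> i)"]) auto
qed

lemma measurable_num_support [measurable]:
  "num_support X J f m \<in> measurable (samples P m) (count_space UNIV)"
proof -
  have "num_support X J f m \<omega> = (\<Sum>i<m. if sol \<omega> ({..<m} - {i}) \<noteq> sol \<omega> {..<m} then 1 else 0)" for \<omega>
    unfolding num_support_def support_constraints_def by (simp add: sum.If_cases Int_def)
  moreover have "(\<lambda>\<omega>. \<Sum>i<m. if sol \<omega> ({..<m} - {i}) \<noteq> sol \<omega> {..<m} then 1 else (0::nat))
      \<in> measurable (samples P m) (count_space UNIV)"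
    using pred_support by (intro measurable_sum_nat measurable_If) auto
  ultimately show ?thesis by (simp cong: measurable_cong)
qed

lemma all_support_iff: "all_support \<omega> {..<m} \<longleftrightarrow> num_support X J f m \<omega> = m"
proof -
  have "support_constraints X J f m \<omega> \<subseteq> {..<m}"
    by (auto simp: support_constraints_def)
  then have "num_support X J f m \<omega> = m \<longleftrightarrow> support_constraints X J f m \<omega> = {..<m}"
    unfolding num_support_def by (metis card_lessThan card_subset_eq finite_lessThan)
  then show ?thesis
    unfolding all_support_def support_constraints_def by (simp add: set_eq_iff) blast
qed

section \<open>Validation counts given the design scenarios\<close>

lemma num_violations_Suc:
  "num_violations P X J f n (Suc M) \<omega> = num_violations P X J f n M \<omega> +
     indicator (violation_set P f (sol \<omega> {..<n})) (\<omega> (n + M))"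
  unfolding num_violations_def by (simp add: add.commute)

lemma num_violations_cong:
  assumes "\<And>i. i < n + M \<Longrightarrow> \<omega> i = \<omega>' i"
  shows "num_violations P X J f n M \<omega> = num_violations P X J f n M \<omega>'"
proof -
  have "sol \<omega> {..<n} = sol \<omega>' {..<n}"
    using assms by (intro scenario_solution_cong image_cong) auto
  then show ?thesis unfolding num_violations_def using assms by simp
qed

lemma measurable_num_violations [measurable]:
  "num_violations P X J f n M \<in> measurable (samples P (n + M)) (count_space UNIV)"
proof -
  have "num_violations P X J f n M \<omega> = (\<Sum>l<M. if 0 < f (sol \<omega> {..<n}) (\<omega> (n + l)) then 1 else 0)"
    if "\<omega> \<in> space (samples P (n + M))" for \<omega>
    using that unfolding num_violations_def
    by (intro sum.cong) (auto simp: violation_set_def indicator_def space_PiM PiE_iff)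
  moreover have "(\<lambda>\<omega>. \<Sum>l<M. if 0 < f (sol \<omega> {..<n}) (\<omega> (n + l)) then 1 else (0::nat))
      \<in> measurable (samples P (n + M)) (count_space UNIV)"
    using pred_violates_index[of "{..<n}" "n + M"] by (intro measurable_sum_nat measurable_If) auto
  ultimately show ?thesis by (simp cong: measurable_cong)
qed

lemma measurable_restrict_samples [measurable]:
  "(\<lambda>\<omega>. restrict \<omega> {..<n}) \<in> measurable (samples P (n + M)) (samples P n)"
  by (intro measurable_restrict_subset) auto

lemma measurable_comp_num_violations:
  fixes \<phi> :: "(nat \<Rightarrow> 'b) \<Rightarrow> nat \<Rightarrow> ennreal"
  assumes [measurable]: "\<And>l. (\<lambda>\<omega>. \<phi> \<omega> l) \<in> borel_measurable (samples P n)"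
  shows "(\<lambda>\<omega>. \<phi> (restrict \<omega> {..<n}) (num_violations P X J f n M \<omega>))
      \<in> borel_measurable (samples P (n + M))"
  by (rule measurable_compose_countable[where f = "\<lambda>l \<omega>. \<phi> (restrict \<omega> {..<n}) l"]) measurable

text \<open>Induction on \<open>M\<close>, integrating out the last scenario; \<open>\<phi>\<close>
  is arbitrary because each step replaces it by an average. Used for the true validation scenarios
  and also for the design scenarios outside a candidate support set.\<close>

lemma nn_integral_num_violations:
  fixes \<phi> :: "(nat \<Rightarrow> 'b) \<Rightarrow> nat \<Rightarrow> ennreal"
  assumes "\<And>l. (\<lambda>\<omega>. \<phi> \<omega> l) \<in> borel_measurable (samples P n)"
  shows "(\<integral>\<^sup>+\<omega>. \<phi> (restrict \<omega> {..<n}) (num_violations P X J f n M \<omega>) \<partial>samples P (n + M)) =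
    (\<integral>\<^sup>+\<omega>. (\<Sum>l\<le>M. of_nat (M choose l) * ennreal (V n \<omega>) ^ l * ennreal (1 - V n \<omega>) ^ (M - l) * \<phi> \<omega> l)
      \<partial>samples P n)"
  using assms
proof (induction M arbitrary: \<phi>)
  case 0
  show ?case
  proof -
    have "restrict \<omega> {..<n} = \<omega>" if "\<omega> \<in> space (samples P n)" for \<omega>
      using that by (metis PiE_restrict space_PiM)
    then show ?thesis
      by (auto intro!: nn_integral_cong simp: num_violations_def simp del: restrict_apply)
  qed
next
  case (Suc M)
  note [measurable] = Suc.prems
  \<comment> \<open>The average of \<open>\<phi>\<close> over the last scenario, which is violated
    with probability \<open>V n \<omega>\<close>.\<close>
  define \<phi>' where "\<phi>' \<omega> l = ennreal (V n \<omega>) * \<phi> \<omega> (Suc l) + ennreal (1 - V n \<omega>) * \<phi> \<omega> l" for \<omega> l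
  have \<phi>'_meas: "(\<lambda>\<omega>. \<phi>' \<omega> l) \<in> borel_measurable (samples P n)" for l
    unfolding \<phi>'_def by measurable
  have insert: "{..<n + Suc M} = insert (n + M) {..<n + M}" by auto
  have meas: "(\<lambda>\<omega>. \<phi> (restrict \<omega> {..<n}) (num_violations P X J f n (Suc M) \<omega>))
      \<in> borel_measurable (samples P (n + Suc M))"
    by (rule measurable_comp_num_violations) (rule Suc.prems)
  have step: "(\<integral>\<^sup>+y. \<phi> (restrict (w(n + M := y)) {..<n}) (num_violations P X J f n (Suc M) (w(n + M := y))) \<partial>P)
      = \<phi>' (restrict w {..<n}) (num_violations P X J f n M w)" for w
  proof -
    let ?w = "restrict w {..<n}" and ?W = "violation_set P f (sol w {..<n})" and ?r = "num_violations P X J f n M w"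
    have 1: "restrict (w(n + M := y)) {..<n} = ?w" for y by auto
    have 2: "sol (w(n + M := y)) {..<n} = sol w {..<n}" for y
      by (intro scenario_solution_cong image_cong) auto
    have 3: "num_violations P X J f n M (w(n + M := y)) = ?r" for y
      by (intro num_violations_cong) auto
    have "(\<integral>\<^sup>+y. \<phi> (restrict (w(n + M := y)) {..<n}) (num_violations P X J f n (Suc M) (w(n + M := y))) \<partial>P)
      = (\<integral>\<^sup>+y. \<phi> ?w (Suc ?r) * indicator ?W y + \<phi> ?w ?r * indicator (space P - ?W) y \<partial>P)"
      by (intro nn_integral_cong) (auto simp: 1 2 3 num_violations_Suc split: split_indicator)
    also have "\<dots> = \<phi> ?w (Suc ?r) * emeasure P ?W + \<phi> ?w ?r * emeasure P (space P - ?W)"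
      by (subst nn_integral_add) (auto simp: nn_integral_cmult_indicator)
    also have "emeasure P ?W = ennreal (V n w)"
      unfolding violation_prob_def by (rule emeasure_eq_measure)
    also have "emeasure P (space P - ?W) = ennreal (1 - V n w)"
      unfolding violation_prob_def by (simp add: emeasure_eq_measure prob_compl)
    finally show ?thesis
      by (simp only: \<phi>'_def sol_restrict[OF order_refl] mult.commute)
  qed
  have "(\<integral>\<^sup>+\<omega>. \<phi> (restrict \<omega> {..<n}) (num_violations P X J f n (Suc M) \<omega>) \<partial>samples P (n + Suc M)) =
    (\<integral>\<^sup>+\<omega>. \<phi>' (restrict \<omega> {..<n}) (num_violations P X J f n M \<omega>) \<partial>samples P (n + M))"
    using samples.product_nn_integral_insert[of "{..<n + M}" "n + M", OF _ _ meas[unfolded insert]]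
    unfolding insert step by simp
  also have "\<dots> = (\<integral>\<^sup>+\<omega>. (\<Sum>l\<le>M. of_nat (M choose l) * ennreal (V n \<omega>) ^ l * ennreal (1 - V n \<omega>) ^ (M - l) * \<phi>' \<omega> l)
      \<partial>samples P n)"
    by (rule Suc.IH) (rule \<phi>'_meas)
  finally show ?case
    unfolding \<phi>'_def binomial_sum_Suc .
qed

section \<open>Exchangeability and the number of support constraints\<close>

lemma sol_reindex:
  "I \<subseteq> {..<m} \<Longrightarrow> sol (\<lambda>i\<in>{..<m}. \<omega> (\<pi> i)) I = sol \<omega> (\<pi> ` I)"
  by (intro scenario_solution_cong) (force simp: image_image)

text \<open>Injectivity makes \<open>\<pi>\<close> commute with the removal of an index.\<close>

lemma all_support_reindex:
  assumes "inj_on \<pi> {..<m}" "I \<subseteq> {..<m}"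
  shows "all_support (\<lambda>i\<in>{..<m}. \<omega> (\<pi> i)) I \<longleftrightarrow> all_support \<omega> (\<pi> ` I)"
proof -
  have "\<pi> ` (I - {i}) = \<pi> ` I - {\<pi> i}" if "i \<in> I" for i
    using assms that by (auto simp: inj_on_def subset_iff)
  moreover have "sol (\<lambda>i\<in>{..<m}. \<omega> (\<pi> i)) (I - {i}) = sol \<omega> (\<pi> ` (I - {i}))" for i
    using assms(2) by (intro sol_reindex) auto
  ultimately show ?thesis
    unfolding all_support_def by (simp add: sol_reindex[OF assms(2)])
qed

text \<open>Lets the scenarios outside \<open>{..<n}\<close> of a single program be treated as
  validation scenarios.\<close>

lemma num_violations_eq_0_iff:
  assumes "\<omega> \<in> space (samples P (n + M))"
  shows "num_violations P X J f n M \<omega> = 0 \<longleftrightarrow> (\<forall>j\<in>{..<n + M} - {..<n}. f (sol \<omega> {..<n}) (\<omega> j) \<le> 0)"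
proof -
  have "num_violations P X J f n M \<omega> = 0 \<longleftrightarrow> (\<forall>l<M. f (sol \<omega> {..<n}) (\<omega> (n + l)) \<le> 0)"
    using assms unfolding num_violations_def
    by (auto simp: violation_set_def indicator_def space_PiM PiE_iff not_less)
  also have "\<dots> \<longleftrightarrow> (\<forall>j\<in>(\<lambda>l. n + l) ` {..<M}. f (sol \<omega> {..<n}) (\<omega> j) \<le> 0)"
    by auto
  also have "(\<lambda>l. n + l) ` {..<M} = {..<n + M} - {..<n}"
    using image_add_atLeastLessThan[of n 0 M] by (auto simp: atLeast0LessThan)
  finally show ?thesis .
qed

lemma distr_samples_reindex:
  assumes "bij_betw \<pi> {..<m} {..<m}"
  shows "distr (samples P m) (samples P m) (\<lambda>\<omega>. \<lambda>i\<in>{..<m}. \<omega> (\<pi> i)) = samples P m"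
  using assms distr_PiM_reindex[of "{..<m}" "\<lambda>_. P" \<pi> "{..<m}"]
  by (auto simp: bij_betw_def prob_space_axioms)

lemma obtain_bij_onto_subset:
  assumes "I \<subseteq> {..<m}"
  obtains \<pi> where "bij_betw \<pi> {..<m} {..<m}" "\<pi> ` {..<card I} = I"
proof -
  have "finite I" using assms finite_subset by blast
  have le: "card I \<le> m" using card_mono[OF _ assms] by simp
  obtain g where g: "bij_betw g {..<card I} I"
    using \<open>finite I\<close> by (metis atLeast0LessThan ex_bij_betw_nat_finite)
  have "card {card I..<m} = card ({..<m} - I)"
    using assms \<open>finite I\<close> by (simp add: card_Diff_subset)
  then obtain h where h: "bij_betw h {card I..<m} ({..<m} - I)"
    using finite_same_card_bij[of "{card I..<m}" "{..<m} - I"] by auto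
  define \<pi> where "\<pi> i = (if i < card I then g i else h i)" for i
  have g': "bij_betw \<pi> {..<card I} I"
    using g by (subst bij_betw_cong[of _ _ g]) (auto simp: \<pi>_def)
  moreover have "bij_betw \<pi> {card I..<m} ({..<m} - I)"
    using h by (subst bij_betw_cong[of _ _ h]) (auto simp: \<pi>_def)
  ultimately have "bij_betw \<pi> ({..<card I} \<union> {card I..<m}) (I \<union> ({..<m} - I))"
    by (rule bij_betw_combine) auto
  moreover have "{..<card I} \<union> {card I..<m} = {..<m}" "I \<union> ({..<m} - I) = {..<m}"
    using le assms by auto
  ultimately show thesis
    using that g' by (simp add: bij_betw_def)
qed

text \<open>All \<open>m choose k\<close> candidate support sets contribute equally. For
  \<open>{..<k}\<close> the other \<open>m - k\<close> scenarios must show no violation, which gives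
  the power of \<open>1 - V k \<omega>\<close>. On the right, \<open>m\<close> enters only through
  the binomial coefficient and this power, so different sizes can be compared.\<close>

lemma nn_integral_num_support_eq:
  fixes g :: "real \<Rightarrow> ennreal"
  assumes [measurable]: "g \<in> borel_measurable borel" and k: "k \<le> m"
  shows "(\<integral>\<^sup>+\<omega>. (if num_support X J f m \<omega> = k then g (V m \<omega>) else 0) \<partial>samples P m) =
    of_nat (m choose k) * (\<integral>\<^sup>+\<omega>. ennreal (1 - V k \<omega>) ^ (m - k) *
      (if num_support X J f k \<omega> = k then g (V k \<omega>) else 0) \<partial>samples P k)"
proof -
  \<comment> \<open>The contribution of the candidate support set \<open>I\<close>, written through
    the solution on \<open>I\<close> alone.\<close>
  define F where "F I \<omega> = (if all_support \<omega> I \<and> (\<forall>j\<in>{..<m} - I. f (sol \<omega> I) (\<omega> j) \<le> 0)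
    then g (violation_prob P f (sol \<omega> I)) else 0)" for I \<omega>
  define S where "S = {I. I \<subseteq> {..<m} \<and> card I = k}"
  have "finite S" unfolding S_def by (rule finite_subset[of _ "Pow {..<m}"]) auto
  have card_S: "card S = m choose k" unfolding S_def by (simp add: n_subsets)
  \<comment> \<open>The condition \<open>l = 0\<close> says that none of the remaining scenarios is
    violated.\<close>
  define \<phi> where "\<phi> \<omega> l = (if num_support X J f k \<omega> = k \<and> l = 0 then g (V k \<omega>) else 0)" for \<omega> and l :: nat
  have \<phi>: "(\<lambda>\<omega>. \<phi> \<omega> l) \<in> borel_measurable (samples P k)" for l
    unfolding \<phi>_def by measurable
  have m: "k + (m - k) = m" using k by simp
  have F_first: "F {..<k} \<omega> = \<phi> (restrict \<omega> {..<k}) (num_violations P X J f k (m - k) \<omega>)"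
    if "\<omega> \<in> space (samples P m)" for \<omega>
  proof -
    have "num_support X J f k (restrict \<omega> {..<k}) = num_support X J f k \<omega>"
      by (rule num_support_cong) simp
    then show ?thesis
      using num_violations_eq_0_iff[of \<omega> k "m - k"] that
      unfolding m F_def \<phi>_def all_support_iff by (simp add: sol_restrict del: restrict_apply)
  qed
  have "(\<lambda>\<omega>. \<phi> (restrict \<omega> {..<k}) (num_violations P X J f k (m - k) \<omega>)) \<in> borel_measurable (samples P m)"
    using measurable_comp_num_violations[of \<phi> k "m - k"] \<phi> unfolding m by simp
  then have F_meas: "F {..<k} \<in> borel_measurable (samples P m)"
    using F_first by (simp cong: measurable_cong)

  \<comment> \<open>A permutation carrying \<open>{..<k}\<close> to \<open>I\<close> preserves the
    product measure and transforms \<open>F {..<k}\<close> into \<open>F I\<close>.\<close>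
  have F_any: "F I \<in> borel_measurable (samples P m) \<and>
      integral\<^sup>N (samples P m) (F I) = integral\<^sup>N (samples P m) (F {..<k})"
    if "I \<in> S" for I
  proof -
    have "I \<subseteq> {..<m}" "card I = k" using that by (auto simp: S_def)
    then obtain \<pi> where \<pi>: "bij_betw \<pi> {..<m} {..<m}" "\<pi> ` {..<k} = I"
      using obtain_bij_onto_subset[of I m] by metis
    define R where "R \<omega> = (\<lambda>i\<in>{..<m}. \<omega> (\<pi> i))" for \<omega> :: "nat \<Rightarrow> 'b"
    have R_meas: "R \<in> measurable (samples P m) (samples P m)"
      unfolding R_def using \<pi>
      by (intro measurable_restrict measurable_component_singleton) (auto simp: bij_betw_def)
    have F_R: "F I = (\<lambda>\<omega>. F {..<k} (R \<omega>))"
    proof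
      fix \<omega>
      have sub: "{..<k} \<subseteq> {..<m}" using k by auto
      have "{..<m} - I = \<pi> ` ({..<m} - {..<k})"
        using \<pi> sub by (subst inj_on_image_set_diff[of \<pi> "{..<m}"]) (auto simp: bij_betw_def)
      then have "(\<forall>j\<in>{..<m} - I. f (sol \<omega> I) (\<omega> j) \<le> 0) \<longleftrightarrow>
          (\<forall>j\<in>{..<m} - {..<k}. f (sol \<omega> I) (R \<omega> j) \<le> 0)"
        by (simp add: R_def)
      moreover have "all_support (R \<omega>) {..<k} \<longleftrightarrow> all_support \<omega> I"
        using all_support_reindex[OF _ sub] \<pi> unfolding R_def by (auto simp: bij_betw_def)
      moreover have "sol (R \<omega>) {..<k} = sol \<omega> I"
        using sol_reindex[OF sub] \<pi> unfolding R_def by simp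
      ultimately show "F I \<omega> = F {..<k} (R \<omega>)" unfolding F_def by simp
    qed
    have "distr (samples P m) (samples P m) R = samples P m"
      using distr_samples_reindex[OF \<pi>(1)] unfolding R_def .
    then have "integral\<^sup>N (samples P m) (F {..<k}) = integral\<^sup>N (samples P m) (F I)"
      using nn_integral_distr[OF R_meas, of "F {..<k}"] F_meas unfolding F_R by simp
    then show ?thesis
      using measurable_compose[OF R_meas F_meas] unfolding F_R by simp
  qed

  have "AE \<omega> in samples P m. (if num_support X J f m \<omega> = k then g (V m \<omega>) else 0) = (\<Sum>I\<in>S. F I \<omega>)"
    using non_degenerate[unfolded non_degenerate_def, rule_format, of m] AE_space
  proof eventually_elim
    case (elim \<omega>)
    let ?C = "support_constraints X J f m \<omega>"
    \<comment> \<open>By non-degeneracy, the full solution is the one on \<open>I\<close> whenever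
      \<open>I\<close> is the support set, so both violation probabilities agree.\<close>
    have "F I \<omega> = (if ?C = I then g (V m \<omega>) else 0)" if "I \<in> S" for I
      using support_constraints_eq_iff[of \<omega> m I] elim that space_samples_image[of \<omega> m "{..<m}"]
      unfolding F_def S_def by auto
    then have "(\<Sum>I\<in>S. F I \<omega>) = (\<Sum>I\<in>S. if ?C = I then g (V m \<omega>) else 0)"
      by (rule sum.cong[OF refl])
    also have "\<dots> = (if ?C \<in> S then g (V m \<omega>) else 0)"
      using \<open>finite S\<close> by simp
    also have "?C \<in> S \<longleftrightarrow> num_support X J f m \<omega> = k"
      unfolding S_def num_support_def support_constraints_def by auto
    finally show ?case by simp
  qed
  then have "(\<integral>\<^sup>+\<omega>. (if num_support X J f m \<omega> = k then g (V m \<omega>) else 0) \<partial>samples P m)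
      = (\<integral>\<^sup>+\<omega>. (\<Sum>I\<in>S. F I \<omega>) \<partial>samples P m)"
    by (rule nn_integral_cong_AE)
  also have "\<dots> = (\<Sum>I\<in>S. integral\<^sup>N (samples P m) (F I))"
    using F_any by (intro nn_integral_sum) auto
  also have "\<dots> = of_nat (m choose k) * integral\<^sup>N (samples P m) (F {..<k})"
    using F_any by (simp add: card_S)
  also have "integral\<^sup>N (samples P m) (F {..<k}) =
      (\<integral>\<^sup>+\<omega>. \<phi> (restrict \<omega> {..<k}) (num_violations P X J f k (m - k) \<omega>) \<partial>samples P m)"
    using F_first by (intro nn_integral_cong) auto
  also have "\<dots> = (\<integral>\<^sup>+\<omega>. (\<Sum>l\<le>m - k. of_nat (m - k choose l) * ennreal (V k \<omega>) ^ l *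
      ennreal (1 - V k \<omega>) ^ (m - k - l) * \<phi> \<omega> l) \<partial>samples P k)"
    using nn_integral_num_violations[of \<phi> k "m - k"] \<phi> unfolding m by simp
  also have "\<dots> = (\<integral>\<^sup>+\<omega>. ennreal (1 - V k \<omega>) ^ (m - k) *
      (if num_support X J f k \<omega> = k then g (V k \<omega>) else 0) \<partial>samples P k)"
  proof (intro nn_integral_cong)
    fix \<omega>
    have "(\<Sum>l\<le>m - k. of_nat (m - k choose l) * ennreal (V k \<omega>) ^ l * ennreal (1 - V k \<omega>) ^ (m - k - l) * \<phi> \<omega> l)
      = (\<Sum>l\<in>{0}. of_nat (m - k choose l) * ennreal (V k \<omega>) ^ l * ennreal (1 - V k \<omega>) ^ (m - k - l) * \<phi> \<omega> l)"
      by (rule sum.mono_neutral_right) (auto simp: \<phi>_def)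
    then show "(\<Sum>l\<le>m - k. of_nat (m - k choose l) * ennreal (V k \<omega>) ^ l * ennreal (1 - V k \<omega>) ^ (m - k - l) * \<phi> \<omega> l)
      = ennreal (1 - V k \<omega>) ^ (m - k) * (if num_support X J f k \<omega> = k then g (V k \<omega>) else 0)"
      by (simp add: \<phi>_def)
  qed
  finally show ?thesis .
qed

section \<open>The probabilistic guarantee\<close>

lemma sum_nn_integral_num_support_le_1:
  assumes "finite K"
  shows "(\<Sum>k\<in>K. \<integral>\<^sup>+\<omega>. (if num_support X J f m \<omega> = k then 1 else 0) \<partial>samples P m) \<le> 1"
proof -
  interpret S: prob_space "samples P m" by (intro prob_space_PiM prob_space_axioms)
  have "(\<Sum>k\<in>K. \<integral>\<^sup>+\<omega>. (if num_support X J f m \<omega> = k then 1 else 0) \<partial>samples P m)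
      = (\<integral>\<^sup>+\<omega>. (\<Sum>k\<in>K. if num_support X J f m \<omega> = k then 1 else 0) \<partial>samples P m)"
    by (subst nn_integral_sum) auto
  also have "\<dots> \<le> (\<integral>\<^sup>+\<omega>. 1 \<partial>samples P m)"
    using assms by (intro nn_integral_mono) auto
  also have "\<dots> = 1" by (simp add: S.emeasure_space_1)
  finally show ?thesis .
qed

text \<open>Measurability of \<open>E\<close> is part of the claim, since \<open>measure\<close> is
  0 on nonmeasurable sets and the bound alone would say little.\<close>

lemma violation_exceeds_eps_bound:
  fixes M :: nat
  assumes "validation_polynomials \<beta> a \<zeta> N"
    and num_support_le: "\<And>m. AE \<omega> in samples P m. num_support X J f m \<omega> \<le> \<zeta>"
  defines "E \<equiv> {\<omega> \<in> space (samples P (N + M)).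
    eps_bound \<beta> a N M (num_support X J f N \<omega>) (num_violations P X J f N M \<omega>) < V N \<omega>}"
  shows "E \<in> sets (samples P (N + M))" "measure (samples P (N + M)) E \<le> \<beta>"
proof -
  interpret validation_polynomials \<beta> a \<zeta> N by fact
  interpret S: prob_space "samples P (N + M)" by (intro prob_space_PiM prob_space_axioms)
  let ?s = "\<lambda>m \<omega>. num_support X J f m \<omega>"
  define e where "e = eps_bound \<beta> a N M"
  define \<phi> :: "(nat \<Rightarrow> 'b) \<Rightarrow> nat \<Rightarrow> ennreal"
    where "\<phi> \<omega> l = (if e (?s N \<omega>) l < V N \<omega> then 1 else 0)" for \<omega> l
  have e_meas [measurable]: "(\<lambda>\<omega>. e (?s N \<omega>) l) \<in> borel_measurable (samples P N)" for l
    by (rule measurable_compose[OF measurable_num_support]) simp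
  have \<phi>: "(\<lambda>\<omega>. \<phi> \<omega> l) \<in> borel_measurable (samples P N)" for l
    unfolding \<phi>_def by measurable
  note \<phi>_meas [measurable] = measurable_comp_num_violations[of \<phi> N M, OF \<phi>]
  have \<phi>_E: "\<phi> (restrict \<omega> {..<N}) (num_violations P X J f N M \<omega>) = indicator E \<omega>"
    if "\<omega> \<in> space (samples P (N + M))" for \<omega>
  proof -
    have "?s N (restrict \<omega> {..<N}) = ?s N \<omega>" by (rule num_support_cong) simp
    then show ?thesis using that
      by (simp add: \<phi>_def E_def e_def sol_restrict indicator_def del: restrict_apply)
  qed
  have "E = {\<omega> \<in> space (samples P (N + M)). \<phi> (restrict \<omega> {..<N}) (num_violations P X J f N M \<omega>) = 1}"
    using \<phi>_E by (auto simp: indicator_def E_def split: if_splits)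
  also have "\<dots> \<in> sets (samples P (N + M))" by measurable
  finally show E: "E \<in> sets (samples P (N + M))" .

  \<comment> \<open>The conditional probability of exceeding the bound, given \<open>k\<close>
    support constraints and violation probability \<open>v\<close>.\<close>
  define W where "W k v = (\<Sum>l\<le>M. of_nat (M choose l) * ennreal v ^ l * ennreal (1 - v) ^ (M - l) *
    (if e k l < v then 1 else 0))" for k v
  have W_meas [measurable]: "W k \<in> borel_measurable borel" for k
    unfolding W_def by measurable
  \<comment> \<open>\<open>binomial_tail_bound\<close> moved to \<open>ennreal\<close>, with each
    summand arranged so that its \<open>v\<close>-dependent factor later integrates to the
    probability of \<open>k\<close> support constraints among \<open>m\<close> scenarios.\<close>
  have W_bound: "of_nat (N choose k) * (ennreal (1 - v) ^ (N - k) * W k v)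
      \<le> (\<Sum>m=k..N. ennreal (\<beta> * a m) * (of_nat (m choose k) * ennreal (1 - v) ^ (m - k)))"
    if k: "k \<le> \<zeta>" and v: "0 \<le> v" "v \<le> 1" for k v
  proof -
    have "W k v = ennreal (\<Sum>l\<le>M. real (M choose l) * v ^ l * (1 - v) ^ (M - l) * (if e k l < v then 1 else 0))"
      unfolding W_def using v
      by (subst sum_ennreal[symmetric])
        (auto simp: ennreal_mult ennreal_power ennreal_of_nat_eq_real_of_nat intro!: sum.cong)
    then have "of_nat (N choose k) * (ennreal (1 - v) ^ (N - k) * W k v) =
      ennreal (real (N choose k) * (1 - v) ^ (N - k) *
        (\<Sum>l\<le>M. real (M choose l) * v ^ l * (1 - v) ^ (M - l) * (if e k l < v then 1 else 0)))"
      using v by (simp add: ennreal_mult ennreal_power ennreal_of_nat_eq_real_of_nat sum_nonneg mult.assoc)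
    also have "\<dots> \<le> ennreal (\<beta> * (\<Sum>m=k..N. a m * real (m choose k) * (1 - v) ^ (m - k)))"
      unfolding e_def by (intro ennreal_leI binomial_tail_bound k v)
    also have "\<dots> = ennreal (\<Sum>m=k..N. (\<beta> * a m) * (real (m choose k) * (1 - v) ^ (m - k)))"
      by (simp add: sum_distrib_left mult.assoc)
    also have "\<dots> = (\<Sum>m=k..N. ennreal (\<beta> * a m) * (of_nat (m choose k) * ennreal (1 - v) ^ (m - k)))"
      using v beta a_nonneg
      by (subst sum_ennreal[symmetric])
        (auto simp: ennreal_mult ennreal_power ennreal_of_nat_eq_real_of_nat intro!: sum.cong)
    finally show ?thesis .
  qed

  have "emeasure (samples P (N + M)) E =
      (\<integral>\<^sup>+\<omega>. \<phi> (restrict \<omega> {..<N}) (num_violations P X J f N M \<omega>) \<partial>samples P (N + M))"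
    unfolding nn_integral_indicator[OF E, symmetric] by (intro nn_integral_cong) (rule \<phi>_E[symmetric])
  also have "\<dots> = (\<integral>\<^sup>+\<omega>. W (?s N \<omega>) (V N \<omega>) \<partial>samples P N)"
    using nn_integral_num_violations[of \<phi> N M, OF \<phi>] by (simp add: W_def \<phi>_def)
  \<comment> \<open>The almost sure bound on the number of support constraints limits the split to
    \<open>k \<le> \<zeta>\<close>.\<close>
  also have "\<dots> = (\<integral>\<^sup>+\<omega>. (\<Sum>k\<le>\<zeta>. if ?s N \<omega> = k then W k (V N \<omega>) else 0) \<partial>samples P N)"
    using num_support_le[of N] by (intro nn_integral_cong_AE) (auto elim!: eventually_mono)
  also have "\<dots> = (\<Sum>k\<le>\<zeta>. \<integral>\<^sup>+\<omega>. (if ?s N \<omega> = k then W k (V N \<omega>) else 0) \<partial>samples P N)"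
    by (intro nn_integral_sum) measurable
  also have "\<dots> = (\<Sum>k\<le>\<zeta>. of_nat (N choose k) * (\<integral>\<^sup>+\<omega>. ennreal (1 - V k \<omega>) ^ (N - k) *
      (if ?s k \<omega> = k then W k (V k \<omega>) else 0) \<partial>samples P k))"
    using zeta_less by (intro sum.cong refl nn_integral_num_support_eq) auto
  also have "\<dots> \<le> (\<Sum>k\<le>\<zeta>. \<Sum>m=k..N. ennreal (\<beta> * a m) *
      (\<integral>\<^sup>+\<omega>. (if ?s m \<omega> = k then 1 else 0) \<partial>samples P m))"
  proof (intro sum_mono)
    fix k assume "k \<in> {..\<zeta>}"
    then have k: "k \<le> \<zeta>" by simp
    have "of_nat (N choose k) * (\<integral>\<^sup>+\<omega>. ennreal (1 - V k \<omega>) ^ (N - k) *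
        (if ?s k \<omega> = k then W k (V k \<omega>) else 0) \<partial>samples P k)
      = (\<integral>\<^sup>+\<omega>. of_nat (N choose k) * (ennreal (1 - V k \<omega>) ^ (N - k) *
        (if ?s k \<omega> = k then W k (V k \<omega>) else 0)) \<partial>samples P k)"
      by (subst nn_integral_cmult) auto
    also have "\<dots> \<le> (\<integral>\<^sup>+\<omega>. (\<Sum>m=k..N. ennreal (\<beta> * a m) * (of_nat (m choose k) *
        (ennreal (1 - V k \<omega>) ^ (m - k) * (if ?s k \<omega> = k then 1 else 0)))) \<partial>samples P k)"
      using W_bound[OF k] by (intro nn_integral_mono) auto
    also have "\<dots> = (\<Sum>m=k..N. ennreal (\<beta> * a m) * (of_nat (m choose k) *
        (\<integral>\<^sup>+\<omega>. ennreal (1 - V k \<omega>) ^ (m - k) * (if ?s k \<omega> = k then 1 else 0) \<partial>samples P k)))"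
      by (subst nn_integral_sum) (auto simp: nn_integral_cmult)
    \<comment> \<open>The same formula is read backwards, with constant \<open>g\<close> and each
      size \<open>m\<close>.\<close>
    also have "\<dots> = (\<Sum>m=k..N. ennreal (\<beta> * a m) *
        (\<integral>\<^sup>+\<omega>. (if ?s m \<omega> = k then 1 else 0) \<partial>samples P m))"
      using nn_integral_num_support_eq[of "\<lambda>_. 1" k] by (intro sum.cong refl) auto
    finally show "of_nat (N choose k) * (\<integral>\<^sup>+\<omega>. ennreal (1 - V k \<omega>) ^ (N - k) *
        (if ?s k \<omega> = k then W k (V k \<omega>) else 0) \<partial>samples P k)
      \<le> (\<Sum>m=k..N. ennreal (\<beta> * a m) * (\<integral>\<^sup>+\<omega>. (if ?s m \<omega> = k then 1 else 0) \<partial>samples P m))" .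
  qed
  \<comment> \<open>Nonnegative terms with \<open>m < k\<close> make the range rectangular, so that
    the sums can be exchanged.\<close>
  also have "\<dots> \<le> (\<Sum>k\<le>\<zeta>. \<Sum>m=0..N. ennreal (\<beta> * a m) *
      (\<integral>\<^sup>+\<omega>. (if ?s m \<omega> = k then 1 else 0) \<partial>samples P m))"
    by (intro sum_mono sum_mono2) auto
  also have "\<dots> = (\<Sum>m=0..N. ennreal (\<beta> * a m) *
      (\<Sum>k\<le>\<zeta>. \<integral>\<^sup>+\<omega>. (if ?s m \<omega> = k then 1 else 0) \<partial>samples P m))"
    by (subst sum.swap) (simp add: sum_distrib_left)
  also have "\<dots> \<le> (\<Sum>m=0..N. ennreal (\<beta> * a m) * 1)"
    by (intro sum_mono mult_left_mono sum_nn_integral_num_support_le_1) auto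
  also have "\<dots> = ennreal (\<Sum>m=0..N. \<beta> * a m)"
    using beta a_nonneg by (subst sum_ennreal[symmetric]) auto
  also have "(\<Sum>m=0..N. \<beta> * a m) = \<beta>"
    by (simp add: a_sum flip: sum_distrib_left)
  finally show "measure (samples P (N + M)) E \<le> \<beta>"
    using beta by (simp add: S.emeasure_eq_measure)
qed

end

theorem theorem4:
  fixes P :: "'b measure"
    and X :: "(real ^ 'd) set"
    and J :: "real ^ 'd \<Rightarrow> real"
    and f :: "real ^ 'd \<Rightarrow> 'b \<Rightarrow> real"
    and \<zeta> N M :: nat
    and \<beta> :: real
    and a :: "nat \<Rightarrow> real"
  assumes "prob_space P"
    and "convex X" and "closed X"
    and "convex_on UNIV J"
    and "\<And>\<delta>. \<delta> \<in> space P \<Longrightarrow> lower_semicontinuous (\<lambda>x. f x \<delta>)"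
    and "\<And>\<delta>. \<delta> \<in> space P \<Longrightarrow> convex_on UNIV (\<lambda>x. f x \<delta>)"
    and "feasibility_uniqueness P X J f"
    and "scenario_measurable P X J f"
    and "non_degenerate P X J f"
    and "\<zeta> \<le> CARD('d)"
    and "\<And>m. AE \<omega> in samples P m. num_support X J f m \<omega> \<le> \<zeta>"
    and "N > \<zeta>"
    and "0 < \<beta>" and "\<beta> < 1"
    and "\<And>m. m \<le> N \<Longrightarrow> a m \<ge> 0"
    and "(\<Sum>m=\<zeta>..N-1. a m) > 0"
    and "(\<Sum>m=0..N. a m) = 1"
  shows "(\<forall>k\<in>{0..\<zeta>}. \<forall>l\<in>{0..M}. \<exists>!t. t \<in> {0<..<1} \<and> h_poly \<beta> a N M k l t = 0)
    \<and> (\<forall>k\<in>{0..\<zeta>}. \<forall>l\<in>{0..<M}.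
          t_root \<beta> a N M k l > t_root \<beta> a N M k (l + 1)
        \<and> eps_bound \<beta> a N M k l < eps_bound \<beta> a N M k (l + 1))
    \<and> (let E = {\<omega> \<in> space (samples P (N + M)).
                 violation_prob P f (scenario_solution X J f \<omega> {..<N})
                   > eps_bound \<beta> a N M (num_support X J f N \<omega>) (num_violations P X J f N M \<omega>)}
       in E \<in> sets (samples P (N + M)) \<and> measure (samples P (N + M)) E \<le> \<beta>)"
proof -
  interpret validation_polynomials \<beta> a \<zeta> N
    using assms(12-17) by unfold_locales auto
  interpret scenario_program P X J f
    using assms(1,7-9) by (auto simp: scenario_program_def scenario_program_axioms_def)
  show ?thesis
    using h_poly_root_ex1 t_root_strict_antimono
      violation_exceeds_eps_bound[OF validation_polynomials_axioms assms(11)]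
    by (auto simp: Let_def eps_bound_def)
qed

end
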